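(* Let $p\ge 3$ be an integer, and let $P_n^p(t)=\mathbb E_\lambda[t^{\phi^{(n)}(x)}]$ for $n\ge 0$ be the polynomials defined in the context. Write $\Delta_n=\frac{n(n+1)}{2}$ (so $\Delta_{-1}=\Delta_0=0$). Then for every integer $m\ge 0$, $$P_{pm}^p(t)=t^{m\Delta_{p-2}}\,P_m^p(t),$$ and for every integer $m\ge 0$ and every integer $k$ with $0<k<p$, $$P_{pm+k}^p(t)=\frac1p\, t^{m\Delta_{p-2}+\Delta_{k-1}}\Big(\sum_{j=0}^{p-k-1}t^{jk}\Big)P_m^p(t)+\frac1p\, t^{m\Delta_{p-2}+\Delta_{k-2}}\Big(\sum_{j=0}^{k-1}t^{j(p-k)}\Big)P_{m+1}^p(t).$$
   Context: Let $p\ge 3$ be an integer (not necessarily prime). $\Gamma=\{x=(x_0,x_1,x_2,\ldots): x_k\in\{0,1,\ldots,p-1\}\}$ is the compact group of $p$-adic integers (addition with carry to the right), and $\lambda$ is its Haar probability measure; under $\lambda$ the coordinates $x_k$ are i.i.d. uniform on $\{0,\ldots,p-1\}$. $\Gamma'=\Gamma\setminus\{(p-1,p-1,\ldots)\}$. $S:x\mapsto x+1$ with $1=(1,0,0,\ldots)$. For $x\in\Gamma'$, $\phi(x)$ is the first coordinate of $x$ different from $p-1$. Put $\phi^{(0)}=0$ and $\phi^{(m)}(x)=\phi(x)+\phi(Sx)+\cdots+\phi(S^{m-1}x)$ for $m\ge1$; this is defined for $\lambda$-almost every $x$ (outside the countable set of $x$ with $S^jx\notin\Gamma'$ for some $j$).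 Put $P_m^p(t)=\mathbb E_\lambda[t^{\phi^{(m)}(x)}]=\sum_j \lambda(\phi^{(m)}=j)\,t^j$, a polynomial in $t$. *)

theory Defs
  imports "HOL-Probability.Probability"
begin

definition padic_ints :: "nat \<Rightarrow> (nat \<Rightarrow> nat) set"
  where "padic_ints p = {x. \<forall>k. x k < p}"

fun carry :: "nat \<Rightarrow> (nat \<Rightarrow> nat) \<Rightarrow> (nat \<Rightarrow> nat) \<Rightarrow> nat \<Rightarrow> nat"
  where
    "carry p x y 0 = 0"
  | "carry p x y (Suc k) = (x k + y k + carry p x y k) div p"

definition padic_add :: "nat \<Rightarrow> (nat \<Rightarrow> nat) \<Rightarrow> (nat \<Rightarrow> nat) \<Rightarrow> (nat \<Rightarrow> nat)"
  where "padic_add p x y = (\<lambda>k. (x k + y k + carry p x y k) mod p)"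

definition padic_one :: "nat \<Rightarrow> nat"
  where "padic_one = (\<lambda>k. if k = 0 then 1 else 0)"

definition odometer :: "nat \<Rightarrow> (nat \<Rightarrow> nat) \<Rightarrow> (nat \<Rightarrow> nat)"
  where "odometer p x = padic_add p x padic_one"

(* The Haar probability measure, given as the law of i.i.d. uniform digits.  The lemmas
   space_padic_haar, sets_padic_haar, prob_space_padic_haar and padic_haar_invariant below
   confirm that it is a translation invariant Borel probability measure on padic_ints p
   (whose topology is the product topology of discrete spaces). *)
definition padic_haar :: "nat \<Rightarrow> (nat \<Rightarrow> nat) measure"
  where "padic_haar p = PiM UNIV (\<lambda>_. uniform_count_measure {..<p})"

(* The value 0 at the point (p-1, p-1, ...), where phi is undefined, is a dummy. *)
definition phi :: "nat \<Rightarrow> (nat \<Rightarrow> nat) \<Rightarrow> nat"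
  where "phi p x = (if \<exists>k. x k \<noteq> p - 1 then x (LEAST k. x k \<noteq> p - 1) else 0)"

definition phi_sum :: "nat \<Rightarrow> nat \<Rightarrow> (nat \<Rightarrow> nat) \<Rightarrow> nat"
  where "phi_sum p m x = (\<Sum>j<m. phi p ((odometer p ^^ j) x))"

(* The lemma gen_poly_eq_poly below exhibits this function of t as a polynomial. *)
definition gen_poly :: "nat \<Rightarrow> nat \<Rightarrow> real \<Rightarrow> real"
  where "gen_poly p m t = (\<integral>x. t ^ phi_sum p m x \<partial>padic_haar p)"

(* The index ranges over the integers because Delta (-1) = 0 occurs;
   the value is nonnegative at every integer. *)
definition Delta :: "int \<Rightarrow> nat"
  where "Delta n = nat (n * (n + 1) div 2)"

lemma Delta_of_nat: "Delta (int n) = n * (n + 1) div 2"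
  unfolding Delta_def by (metis nat_int of_nat_1 of_nat_add of_nat_mult of_nat_numeral zdiv_int)

lemma Delta_minus_one: "Delta (- 1) = 0"
  by (simp add: Delta_def)

lemma space_padic_haar: "space (padic_haar p) = padic_ints p"
  by (auto simp: padic_haar_def space_PiM space_uniform_count_measure padic_ints_def PiE_iff)

lemma prob_space_padic_haar:
  assumes "p > 0" shows "prob_space (padic_haar p)"
  unfolding padic_haar_def using assms
  by (intro prob_space_PiM prob_space_uniform_count_measure) auto

lemma padic_add_in: "p > 0 \<Longrightarrow> padic_add p a x \<in> padic_ints p"
  by (auto simp: padic_add_def padic_ints_def)

lemma measurable_digit: "(\<lambda>x. x k) \<in> padic_haar p \<rightarrow>\<^sub>M count_space UNIV"
proof -
  have "(\<lambda>x. x k) \<in> padic_haar p \<rightarrow>\<^sub>M uniform_count_measure {..<p}"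
    unfolding padic_haar_def by measurable
  moreover have "(\<lambda>i. i) \<in> uniform_count_measure {..<p} \<rightarrow>\<^sub>M count_space UNIV"
    by (auto simp: measurable_def sets_uniform_count_measure space_uniform_count_measure)
  ultimately show ?thesis by (rule measurable_compose)
qed

lemma measurable_into_padic_haar:
  assumes "\<And>k. (\<lambda>x. f x k) \<in> M \<rightarrow>\<^sub>M count_space UNIV"
    and "\<And>x. x \<in> space M \<Longrightarrow> f x \<in> padic_ints p"
  shows "f \<in> M \<rightarrow>\<^sub>M padic_haar p"
  unfolding padic_haar_def
proof (rule measurable_PiM_single')
  fix k :: nat
  show "(\<lambda>x. f x k) \<in> M \<rightarrow>\<^sub>M uniform_count_measure {..<p}"
  proof (rule measurableI)
    fix A assume "A \<in> sets (uniform_count_measure {..<p})"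
    show "(\<lambda>x. f x k) -` A \<inter> space M \<in> sets M"
      using assms(1)[of k] by (rule measurable_sets) simp
  qed (use assms(2) in \<open>auto simp: padic_ints_def space_uniform_count_measure\<close>)
next
  show "f \<in> space M \<rightarrow> UNIV \<rightarrow>\<^sub>E space (uniform_count_measure {..<p})"
    using assms(2) by (auto simp: padic_ints_def space_uniform_count_measure)
qed

lemma sets_padic_haar:
  "sets (padic_haar p) = sets (restrict_space borel (padic_ints p))"
proof
  let ?R = "restrict_space borel (padic_ints p)"
  have "(\<lambda>x. x k) \<in> borel_measurable (borel :: (nat \<Rightarrow> nat) measure)" for k :: nat
    by (intro borel_measurable_continuous_onI continuous_on_product_coordinates)
  then have "(\<lambda>x. x k) \<in> ?R \<rightarrow>\<^sub>M count_space UNIV" for k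
    by (intro measurable_restrict_space1) (simp add: measurable_cong_sets[OF refl sets_borel_eq_count_space])
  then have "(\<lambda>x. x) \<in> ?R \<rightarrow>\<^sub>M padic_haar p"
    by (intro measurable_into_padic_haar) (auto simp: space_restrict_space)
  from measurable_sets[OF this] show "sets (padic_haar p) \<subseteq> sets ?R"
    using sets.sets_into_space[of _ "padic_haar p"]
    by (auto simp: space_restrict_space space_padic_haar Int_absorb2)
  have "(\<lambda>x. x) \<in> padic_haar p \<rightarrow>\<^sub>M (PiM UNIV (\<lambda>_. borel) :: (nat \<Rightarrow> nat) measure)"
    by (rule measurable_PiM_single') (auto simp: measurable_cong_sets[OF refl sets_borel_eq_count_space] intro: measurable_digit)
  then have "(\<lambda>x. x) \<in> padic_haar p \<rightarrow>\<^sub>M ?R"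
    by (intro measurable_restrict_space2)
      (auto simp: space_padic_haar measurable_cong_sets[OF refl sets_PiM_equal_borel])
  from measurable_sets[OF this] show "sets ?R \<subseteq> sets (padic_haar p)"
    using sets.sets_into_space[of _ ?R]
    by (auto simp: space_restrict_space space_padic_haar Int_absorb2)
qed

lemma measurable_carry [measurable]:
  assumes [measurable]: "\<And>k. (\<lambda>x. f x k) \<in> M \<rightarrow>\<^sub>M count_space UNIV"
    "\<And>k. (\<lambda>x. g x k) \<in> M \<rightarrow>\<^sub>M count_space UNIV"
  shows "(\<lambda>x. carry p (f x) (g x) k) \<in> M \<rightarrow>\<^sub>M count_space UNIV"
proof (induction k)
  case (Suc k)
  note [measurable] = Suc
  have "(\<lambda>x. f x k + g x k + carry p (f x) (g x) k) \<in> M \<rightarrow>\<^sub>M count_space UNIV"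
    by measurable
  then show ?case
    unfolding carry.simps
    by (rule measurable_compose[where g = "\<lambda>i. i div p"]) simp
qed simp

lemma measurable_padic_add:
  assumes "p > 0"
    and [measurable]: "\<And>k. (\<lambda>x. f x k) \<in> M \<rightarrow>\<^sub>M count_space UNIV"
    "\<And>k. (\<lambda>x. g x k) \<in> M \<rightarrow>\<^sub>M count_space UNIV"
  shows "(\<lambda>x. padic_add p (f x) (g x)) \<in> M \<rightarrow>\<^sub>M padic_haar p"
proof (rule measurable_into_padic_haar)
  fix k
  have "(\<lambda>x. f x k + g x k + carry p (f x) (g x) k) \<in> M \<rightarrow>\<^sub>M count_space UNIV"
    by measurable
  then show "(\<lambda>x. padic_add p (f x) (g x) k) \<in> M \<rightarrow>\<^sub>M count_space UNIV"
    unfolding padic_add_def by (rule measurable_compose[where g = "\<lambda>i. i mod p"]) simp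
qed (use assms(1) padic_add_in in auto)

lemma measurable_odometer [measurable]:
  assumes "p > 0" shows "odometer p \<in> padic_haar p \<rightarrow>\<^sub>M padic_haar p"
  unfolding odometer_def[abs_def] using assms by (intro measurable_padic_add measurable_digit) auto

lemma measurable_phi [measurable]: "phi p \<in> padic_haar p \<rightarrow>\<^sub>M count_space UNIV"
proof -
  note [measurable] = measurable_digit[of _ p]
  have "(\<lambda>x. LEAST k. x k \<noteq> p - 1) \<in> padic_haar p \<rightarrow>\<^sub>M count_space UNIV"
    by measurable
  then have [measurable]:
    "(\<lambda>x. (\<lambda>k. x k) (LEAST k. x k \<noteq> p - 1)) \<in> padic_haar p \<rightarrow>\<^sub>M count_space UNIV"
    by (rule measurable_compose_countable[rotated]) measurable
  show ?thesis unfolding phi_def[abs_def] by measurable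
qed

lemma measurable_phi_sum:
  assumes "p > 0" shows "phi_sum p m \<in> padic_haar p \<rightarrow>\<^sub>M count_space UNIV"
proof -
  have [measurable]: "(odometer p ^^ j) \<in> padic_haar p \<rightarrow>\<^sub>M padic_haar p" for j
    by (induction j) (use assms in \<open>auto intro: measurable_comp measurable_odometer simp: id_def\<close>)
  show ?thesis unfolding phi_sum_def[abs_def] by measurable
qed

lemma phi_le:
  assumes "x \<in> padic_ints p" shows "phi p x \<le> p - 2"
proof (cases "\<exists>k. x k \<noteq> p - 1")
  case True
  then have "x (LEAST k. x k \<noteq> p - 1) \<noteq> p - 1" by (rule LeastI_ex)
  moreover have "x (LEAST k. x k \<noteq> p - 1) < p" using assms by (auto simp: padic_ints_def)
  ultimately show ?thesis using True by (auto simp: phi_def)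
qed (simp add: phi_def)

lemma odometer_funpow_in:
  "p > 0 \<Longrightarrow> x \<in> padic_ints p \<Longrightarrow> (odometer p ^^ j) x \<in> padic_ints p"
  by (induction j) (auto simp: odometer_def padic_add_in)

lemma phi_sum_le:
  assumes "p > 0" "x \<in> padic_ints p" shows "phi_sum p m x \<le> m * (p - 2)"
  unfolding phi_sum_def
  using sum_bounded_above[of "{..<m}" "\<lambda>j. phi p ((odometer p ^^ j) x)" "p - 2"]
    odometer_funpow_in[OF assms] phi_le by auto

lemma gen_poly_eq_poly:
  assumes "p > 0"
  shows "gen_poly p m t =
    poly (\<Sum>j\<le>m * (p - 2). monom (measure (padic_haar p) {x \<in> padic_ints p. phi_sum p m x = j}) j) t"
proof -
  interpret prob_space "padic_haar p" using assms by (rule prob_space_padic_haar)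
  note [measurable] = measurable_phi_sum[OF assms, of m]
  let ?A = "\<lambda>j. {x \<in> padic_ints p. phi_sum p m x = j}"
  have A: "?A j \<in> sets (padic_haar p)" for j
    unfolding space_padic_haar[symmetric] by measurable
  have "gen_poly p m t = (\<integral>x. (\<Sum>j\<le>m * (p - 2). indicator (?A j) x * t ^ j) \<partial>padic_haar p)"
    unfolding gen_poly_def
  proof (rule Bochner_Integration.integral_cong[OF refl])
    fix x assume "x \<in> space (padic_haar p)"
    then have x: "x \<in> padic_ints p" by (simp add: space_padic_haar)
    have "(\<Sum>j\<le>m * (p - 2). indicator (?A j) x * t ^ j)
        = (\<Sum>j\<le>m * (p - 2). if phi_sum p m x = j then t ^ j else 0)"
      using x by (intro sum.cong) auto
    then show "t ^ phi_sum p m x = (\<Sum>j\<le>m * (p - 2). indicator (?A j) x * t ^ j)"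
      using phi_sum_le[OF assms x, of m] by simp
  qed
  also have "\<dots> = (\<Sum>j\<le>m * (p - 2). \<integral>x. indicator (?A j) x * t ^ j \<partial>padic_haar p)"
    using A by (intro Bochner_Integration.integral_sum integrable_mult_left)
      (auto simp: integrable_real_indicator emeasure_eq_measure)
  also have "\<dots> = (\<Sum>j\<le>m * (p - 2). measure (padic_haar p) (?A j) * t ^ j)"
    using A by (intro sum.cong) (auto simp: space_padic_haar intro: arg_cong[where f = "measure _"])
  finally show ?thesis by (simp add: poly_sum poly_monom)
qed

lemma carry_cong: "(\<And>i. i < n \<Longrightarrow> x i = y i) \<Longrightarrow> carry p a x n = carry p a y n"
  by (induction n) auto

lemma padic_add_cancel:
  assumes "p > 0" "\<And>i. i < n \<Longrightarrow> x i < p" "\<And>i. i < n \<Longrightarrow> y i < p"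
    and "\<And>i. i < n \<Longrightarrow> padic_add p a x i = padic_add p a y i"
  shows "i < n \<Longrightarrow> x i = y i"
proof (induction i rule: less_induct)
  case (less i)
  then have "carry p a x i = carry p a y i" by (intro carry_cong) auto
  then have "((a i + carry p a x i) + x i) mod p = ((a i + carry p a x i) + y i) mod p"
    using assms(4)[OF less.prems] by (simp add: padic_add_def add_ac)
  then have "x i mod p = y i mod p"
    by (auto simp: nat_mod_eq_iff add.assoc)
  then show ?case using assms(2,3)[OF less.prems] by simp
qed

lemma padic_haar_cylinder:
  assumes "p > 0" and T: "T \<subseteq> {..<n} \<rightarrow>\<^sub>E {..<p}"
  defines "C \<equiv> \<lambda>T. {x \<in> padic_ints p. restrict x {..<n} \<in> T}"
  shows "C T \<in> sets (padic_haar p)"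
    and "emeasure (padic_haar p) (C T) = of_nat (card T) * ennreal (1 / real p) ^ n"
proof -
  let ?U = "\<lambda>_::nat. uniform_count_measure {..<p}"
  interpret product_prob_space ?U UNIV
    using assms(1) by (intro product_prob_spaceI prob_space_uniform_count_measure) auto
  have fin: "finite T" using T by (rule finite_subset) (auto intro: finite_PiE)
  have C: "C {s} = prod_emb UNIV ?U {..<n} (PiE {..<n} (\<lambda>i. {s i}))"
    if "s \<in> T" for s
  proof -
    have "s \<in> {..<n} \<rightarrow>\<^sub>E {..<p}" using that T by auto
    then show ?thesis
      by (auto simp: C_def prod_emb_def padic_ints_def space_uniform_count_measure PiE_iff
          extensional_def restrict_def fun_eq_iff)
  qed
  have meas: "C {s} \<in> sets (padic_haar p)" if "s \<in> T" for s
    unfolding C[OF that] padic_haar_def using that T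
    by (intro sets_PiM_I) (auto simp: sets_uniform_count_measure PiE_iff)
  have em: "emeasure (padic_haar p) (C {s}) = ennreal (1 / real p) ^ n" if "s \<in> T" for s
  proof -
    have "s i < p" if "i < n" for i using that \<open>s \<in> T\<close> T by (auto simp: PiE_iff)
    then show ?thesis
      unfolding C[OF that] padic_haar_def
      by (subst emeasure_PiM_emb)
        (auto simp: sets_uniform_count_measure emeasure_uniform_count_measure)
  qed
  have U: "C T = (\<Union>s\<in>T. C {s})" by (auto simp: C_def)
  show "C T \<in> sets (padic_haar p)" unfolding U using fin meas by auto
  have "emeasure (padic_haar p) (C T) = (\<Sum>s\<in>T. emeasure (padic_haar p) (C {s}))"
    unfolding U using fin meas
    by (intro sum_emeasure[symmetric]) (auto simp: disjoint_family_on_def C_def)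
  also have "\<dots> = of_nat (card T) * ennreal (1 / real p) ^ n"
    using em by simp
  finally show "emeasure (padic_haar p) (C T) = of_nat (card T) * ennreal (1 / real p) ^ n" .
qed

lemma padic_haar_invariant:
  assumes "p > 0" "a \<in> padic_ints p"
  shows "distr (padic_haar p) (padic_haar p) (padic_add p a) = padic_haar p"
proof -
  let ?U = "\<lambda>_::nat. uniform_count_measure {..<p}"
  let ?D = "distr (padic_haar p) (padic_haar p) (padic_add p a)"
  have meas: "padic_add p a \<in> padic_haar p \<rightarrow>\<^sub>M padic_haar p"
    using assms by (intro measurable_padic_add measurable_digit) auto
  have "padic_haar p = ?D"
  proof (rule measure_eqI_PiM_infinite)
    show "sets (padic_haar p) = sets (PiM UNIV ?U)" "sets ?D = sets (PiM UNIV ?U)"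
      by (simp_all add: padic_haar_def)
    show "finite_measure (padic_haar p)"
      using prob_space_padic_haar[OF assms(1)] by (simp add: prob_space.finite_measure)
    fix A J assume J: "finite (J :: nat set)" and A: "\<And>i. i \<in> J \<Longrightarrow> A i \<in> sets (?U i)"
    obtain n where n: "J \<subseteq> {..<n}" using J finite_nat_iff_bounded by blast
    let ?B = "{..<n} \<rightarrow>\<^sub>E {..<p}"
    let ?C = "\<lambda>T. {x \<in> padic_ints p. restrict x {..<n} \<in> T}"
    define g where "g x = restrict (padic_add p a x) {..<n}" for x
    define T where "T = {s \<in> ?B. \<forall>i\<in>J. s i \<in> A i}"
    define T' where "T' = {s \<in> ?B. g s \<in> T}"
    have emb: "prod_emb UNIV ?U J (PiE J A) = ?C T"
      using n by (auto simp: prod_emb_def T_def padic_ints_def space_uniform_count_measure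
          PiE_iff extensional_def subset_eq)
    have inj: "inj_on g ?B"
    proof (rule inj_onI)
      fix x y assume xy: "x \<in> ?B" "y \<in> ?B" "g x = g y"
      have "padic_add p a x i = padic_add p a y i" if "i < n" for i
        using fun_cong[OF xy(3), of i] that by (simp add: g_def)
      then have "x i = y i" if "i < n" for i
        using padic_add_cancel[of p n x y a i] xy that assms(1) by (auto simp: PiE_iff)
      with xy(1,2) show "x = y" by (intro PiE_ext) auto
    qed
    have fin: "finite ?B" by (auto intro: finite_PiE)
    have into: "g ` ?B \<subseteq> ?B"
      using assms(1) by (intro image_subsetI PiE_I) (simp_all add: g_def padic_add_def)
    have surj: "g ` ?B = ?B" by (rule endo_inj_surj[OF fin into inj])
    have "bij_betw g T' T"
      unfolding bij_betw_def
    proof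
      show "inj_on g T'" by (rule inj_on_subset[OF inj]) (auto simp: T'_def)
      have "T \<subseteq> g ` ?B" using surj by (auto simp: T_def)
      then show "g ` T' = T" by (auto simp: T'_def)
    qed
    then have card: "card T' = card T" by (rule bij_betw_same_card)
    have pre: "padic_add p a -` ?C T \<inter> space (padic_haar p) = ?C T'"
    proof -
      have "g (restrict x {..<n}) = restrict (padic_add p a x) {..<n}" for x
      proof -
        have "carry p a (restrict x {..<n}) i = carry p a x i" if "i < n" for i
          using that by (intro carry_cong) auto
        then show ?thesis by (simp add: g_def padic_add_def fun_eq_iff)
      qed
      moreover have "restrict x {..<n} \<in> ?B" if "x \<in> padic_ints p" for x
        using that by (auto simp: padic_ints_def)
      ultimately show ?thesis
        using padic_add_in[OF assms(1)] by (auto simp: space_padic_haar T'_def)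
    qed
    have sub: "T \<subseteq> ?B" "T' \<subseteq> ?B" by (auto simp: T_def T'_def)
    show "emeasure (padic_haar p) (prod_emb UNIV ?U J (PiE J A)) =
        emeasure ?D (prod_emb UNIV ?U J (PiE J A))"
      unfolding emb emeasure_distr[OF meas padic_haar_cylinder(1)[OF assms(1) sub(1)]] pre
        padic_haar_cylinder(2)[OF assms(1) sub(1)] padic_haar_cylinder(2)[OF assms(1) sub(2)] card ..
  qed
  then show ?thesis ..
qed

end

theory Submission
  imports Defs
begin

text \<open>Splitting off the first digit, the orbit of \<open>a # y\<close> runs through the digits
  \<open>a, a + 1, \<dots>\<close> modulo \<open>p\<close>, and the odometer acts on \<open>y\<close> each time the
  first digit leaves \<open>p - 1\<close>, which is also the only time when \<open>phi\<close> looks at \<open>y\<close>.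
  Hence the Birkhoff sum of length \<open>p m + k\<close> at \<open>a # y\<close> is an explicit
  constant plus the Birkhoff sum at \<open>y\<close> of length \<open>m\<close> (if \<open>a + k < p\<close>) or \<open>m + 1\<close>
  (otherwise).  Averaging over \<open>a\<close> gives the recursion.\<close>

text \<open>The carry 1 out of the leading digit \<open>p - 1\<close> enters \<open>y\<close> at its
  digit 0, exactly where adding \<open>padic_one\<close> to \<open>y\<close> would contribute its
  only nonzero digit. From there on both additions carry alike.\<close>

lemma carry_case_nat_max:
  assumes "p > 0"
  shows "carry p (case_nat (p - 1) y) padic_one (Suc k) = padic_one k + carry p y padic_one k"
  using assms by (induction k) (auto simp: padic_one_def add_ac)

lemma carry_case_nat_less:
  assumes "Suc a < p" "y \<in> padic_ints p"
  shows "carry p (case_nat a y) padic_one (Suc k) = 0"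
  using assms by (induction k) (auto simp: padic_one_def padic_ints_def)

lemma odometer_case_nat_max:
  assumes "p > 0"
  shows "odometer p (case_nat (p - 1) y) = case_nat 0 (odometer p y)"
proof
  fix k show "odometer p (case_nat (p - 1) y) k = case_nat 0 (odometer p y) k"
    using assms carry_case_nat_max[OF assms, of y]
    by (cases k) (simp_all add: odometer_def padic_add_def padic_one_def add.assoc del: carry.simps(2))
qed

lemma odometer_case_nat_less:
  assumes "Suc a < p" "y \<in> padic_ints p"
  shows "odometer p (case_nat a y) = case_nat (Suc a) y"
proof
  fix k show "odometer p (case_nat a y) k = case_nat (Suc a) y k"
    using assms carry_case_nat_less[OF assms]
    by (cases k) (simp_all add: odometer_def padic_add_def padic_one_def padic_ints_def del: carry.simps(2))
qed

lemma phi_case_nat: "phi p (case_nat a y) = (if a = p - 1 then phi p y else a)"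
proof (cases "a = p - 1")
  case True
  show ?thesis
  proof (cases "\<exists>k. y k \<noteq> p - 1")
    case ex: True
    then obtain k where k: "y k \<noteq> p - 1" by blast
    have "(LEAST k. case_nat a y k \<noteq> p - 1) = Suc (LEAST k. case_nat a y (Suc k) \<noteq> p - 1)"
      using k True by (intro Least_Suc[where n = "Suc k"]) auto
    then have "case_nat a y (LEAST k. case_nat a y k \<noteq> p - 1) = y (LEAST k. y k \<noteq> p - 1)"
      by simp
    moreover have "\<exists>k. case_nat a y k \<noteq> p - 1" using k by (intro exI[of _ "Suc k"]) simp
    ultimately show ?thesis unfolding phi_def using True ex by (simp only: if_True simp_thms)
  next
    \<comment> \<open>All digits equal \<open>p - 1\<close>, and both sides take the dummy value 0.
      The identity therefore holds pointwise, without an exceptional null set.\<close>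
    case False
    then have "\<not> (\<exists>k. case_nat a y k \<noteq> p - 1)" using True by (auto split: nat.split)
    then show ?thesis unfolding phi_def using True False by (simp only: if_False simp_thms if_True)
  qed
next
  case False
  then have "(LEAST k. case_nat a y k \<noteq> p - 1) = 0" by (intro Least_equality) auto
  moreover have "\<exists>k. case_nat a y k \<noteq> p - 1" using False by (intro exI[of _ 0]) simp
  ultimately show ?thesis using False by (simp add: phi_def)
qed

text \<open>Each of the \<open>j div p\<close> passages of the first digit from \<open>p - 1\<close>
  to 0 moves the tail once. Starting at digit 0 is enough: \<open>case_nat a y\<close> is reached
  from \<open>case_nat 0 y\<close> after \<open>a\<close> steps.\<close>

lemma odometer_funpow_case_nat_zero:
  assumes "p > 0" "y \<in> padic_ints p"
  shows "(odometer p ^^ j) (case_nat 0 y) = case_nat (j mod p) ((odometer p ^^ (j div p)) y)"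
proof (induction j)
  case (Suc j)
  show ?case
  proof (cases "Suc (j mod p) = p")
    case True
    then have "j mod p = p - 1" by simp
    then have "(odometer p ^^ Suc j) (case_nat 0 y) =
        case_nat 0 (odometer p ((odometer p ^^ (j div p)) y))"
      by (simp only: funpow.simps comp_apply Suc odometer_case_nat_max[OF assms(1)])
    moreover have "Suc j mod p = 0" "Suc j div p = Suc (j div p)"
      using True by (simp_all add: mod_Suc div_Suc)
    ultimately show ?thesis by (simp only: funpow.simps comp_apply)
  next
    case False
    then have "Suc (j mod p) < p" using assms(1) by (simp add: Suc_lessI)
    then have "(odometer p ^^ Suc j) (case_nat 0 y) =
        case_nat (Suc (j mod p)) ((odometer p ^^ (j div p)) y)"
      by (simp only: funpow.simps comp_apply Suc odometer_case_nat_less[OF _ odometer_funpow_in[OF assms]])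
    moreover have "Suc j mod p = Suc (j mod p)" "Suc j div p = j div p"
      using False by (simp_all add: mod_Suc div_Suc)
    ultimately show ?thesis by (simp only:)
  qed
qed (simp only: funpow.simps id_apply mod_0 div_0)

lemma phi_sum_add: "phi_sum p (a + n) x = phi_sum p a x + phi_sum p n ((odometer p ^^ a) x)"
proof -
  have "(odometer p ^^ (a + j)) x = (odometer p ^^ j) ((odometer p ^^ a) x)" for j
    by (metis add.commute comp_apply funpow_add)
  then show ?thesis unfolding phi_sum_def by (induction n) simp_all
qed

text \<open>A full block of \<open>p\<close> steps collects the digits 0 to \<open>p - 2\<close>
  and, at digit \<open>p - 1\<close>, one value of \<open>phi\<close> on the tail. The incomplete
  last block stops before digit \<open>p - 1\<close>, so it collects digits only.\<close>

lemma phi_sum_case_nat_zero: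
  assumes "p > 0" "y \<in> padic_ints p"
  shows "phi_sum p n (case_nat 0 y) =
    (n div p) * \<Sum>{..<p - 1} + \<Sum>{..<n mod p} + phi_sum p (n div p) y"
proof (induction n)
  case (Suc n)
  have step: "phi_sum p (Suc n) (case_nat 0 y) = phi_sum p n (case_nat 0 y)
      + (if n mod p = p - 1 then phi p ((odometer p ^^ (n div p)) y) else n mod p)"
    unfolding phi_sum_def by (simp add: odometer_funpow_case_nat_zero[OF assms] phi_case_nat)
  show ?case
  proof (cases "Suc (n mod p) = p")
    case True
    then have "n mod p = p - 1" by simp
    with Suc True step show ?thesis
      by (simp add: mod_Suc div_Suc phi_sum_def)
  next
    case False
    then have "n mod p \<noteq> p - 1" using assms(1) by linarith
    with Suc False step show ?thesis by (simp add: mod_Suc div_Suc)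
  qed
qed (simp add: phi_sum_def)

text \<open>The cocycle identity \<open>phi_sum_add\<close> along the orbit of
  \<open>case_nat 0 y\<close>, split at time \<open>a\<close>. The initial sum stays on the left
  because subtraction of naturals truncates.\<close>

lemma phi_sum_case_nat:
  assumes "a < p" "y \<in> padic_ints p"
  shows "\<Sum>{..<a} + phi_sum p n (case_nat a y) =
    ((a + n) div p) * \<Sum>{..<p - 1} + \<Sum>{..<(a + n) mod p} + phi_sum p ((a + n) div p) y"
proof -
  have p: "p > 0" using assms(1) by simp
  note zero = phi_sum_case_nat_zero[OF p assms(2)]
  have "\<Sum>{..<a} = phi_sum p a (case_nat 0 y)"
    using zero[of a] assms(1) by (simp add: phi_sum_def)
  moreover have "case_nat a y = (odometer p ^^ a) (case_nat 0 y)"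
    using odometer_funpow_case_nat_zero[OF p assms(2), of a] assms(1) by simp
  ultimately show ?thesis using zero[of "a + n"] phi_sum_add by metis
qed

text \<open>These sums are the triangular numbers; the cross term is the source of the exponents
  \<open>j * k\<close> and \<open>j * (p - k)\<close>.\<close>

lemma sum_lessThan_add: "\<Sum>{..<a + b} = \<Sum>{..<a} + \<Sum>{..<b} + a * (b::nat)"
  by (induction b) simp_all

lemma phi_sum_case_nat_low:
  assumes "a + k < p" "y \<in> padic_ints p"
  shows "phi_sum p (p * m + k) (case_nat a y) =
    m * \<Sum>{..<p - 1} + \<Sum>{..<k} + a * k + phi_sum p m y"
proof -
  have "(a + (p * m + k)) div p = m" "(a + (p * m + k)) mod p = a + k"
    using assms(1) by (auto simp: div_nat_eqI mod_nat_eqI algebra_simps)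
  then show ?thesis
    using phi_sum_case_nat[of a p y "p * m + k"] assms by (simp add: sum_lessThan_add)
qed

text \<open>The first digits from \<open>p - k\<close> on are counted downwards from
  \<open>p - 1\<close> by \<open>j\<close>, which makes the exponent linear in \<open>j\<close> with
  slope \<open>p - k\<close>.\<close>

lemma phi_sum_case_nat_high:
  assumes "j < k" "k < p" "y \<in> padic_ints p"
  shows "phi_sum p (p * m + k) (case_nat (p - 1 - j) y) =
    m * \<Sum>{..<p - 1} + \<Sum>{..<k - 1} + j * (p - k) + phi_sum p (m + 1) y"
proof -
  \<comment> \<open>\<open>u\<close> is the final first digit, and \<open>u + v\<close> is the
    initial one; also \<open>u + j = k - 1\<close> and \<open>u + j + v = p - 1\<close>.\<close>
  define u v where "u = k - 1 - j" and "v = p - k"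
  have uv: "k = u + j + 1" "p = u + j + v + 1" using assms by (auto simp: u_def v_def)
  have "p - 1 - j + (p * m + k) = u + p * (m + 1)" unfolding uv by (simp add: algebra_simps)
  moreover have "u < p" using uv by simp
  ultimately have "(p - 1 - j + (p * m + k)) div p = m + 1" "(p - 1 - j + (p * m + k)) mod p = u"
    by (simp_all del: add_Suc_right)
  then have "\<Sum>{..<u + v} + phi_sum p (p * m + k) (case_nat (p - 1 - j) y) =
      (m + 1) * \<Sum>{..<u + j + v} + \<Sum>{..<u} + phi_sum p (m + 1) y"
    using phi_sum_case_nat[of "p - 1 - j" p y "p * m + k"] assms(3) uv by simp
  \<comment> \<open>The mixed second difference of the triangular numbers with increments
    \<open>j\<close> and \<open>v\<close> is \<open>j * v\<close>.\<close>
  moreover have "\<Sum>{..<u + j + v} + \<Sum>{..<u} = \<Sum>{..<u + j} + j * v + \<Sum>{..<u + v}"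
    by (simp add: sum_lessThan_add algebra_simps)
  ultimately show ?thesis using uv by (simp add: algebra_simps)
qed

text \<open>By \<open>PiM_iter\<close>, prepending an independent uniform digit preserves the
  measure. The claim is then Fubini, with integrability from the bound \<open>B\<close> on a
  probability space.\<close>

lemma integral_padic_haar_first_digit:
  fixes f :: "(nat \<Rightarrow> nat) \<Rightarrow> real"
  assumes "p > 0" and [measurable]: "f \<in> borel_measurable (padic_haar p)"
    and bound: "\<And>x. x \<in> padic_ints p \<Longrightarrow> \<bar>f x\<bar> \<le> B"
  shows "(\<integral>x. f x \<partial>padic_haar p) = (\<Sum>a<p. \<integral>y. f (case_nat a y) \<partial>padic_haar p) / real p"
proof -
  let ?U = "uniform_count_measure {..<p}"
  interpret U: prob_space ?U using assms(1) by (intro prob_space_uniform_count_measure) auto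
  interpret P: prob_space "padic_haar p" using assms(1) by (rule prob_space_padic_haar)
  interpret S: sequence_space ?U ..
  interpret UP: pair_prob_space ?U "padic_haar p" ..
  have iter: "distr (?U \<Otimes>\<^sub>M padic_haar p) (padic_haar p) (\<lambda>(a, y). case_nat a y) = padic_haar p"
    using S.PiM_iter by (simp add: padic_haar_def)
  have meas [measurable]: "(\<lambda>(a, y). case_nat a y) \<in> ?U \<Otimes>\<^sub>M padic_haar p \<rightarrow>\<^sub>M padic_haar p"
    unfolding padic_haar_def by measurable
  have "integrable (?U \<Otimes>\<^sub>M padic_haar p) (\<lambda>z. f (case z of (a, y) \<Rightarrow> case_nat a y))"
  proof (rule UP.integrable_const_bound)
    show "AE z in ?U \<Otimes>\<^sub>M padic_haar p. norm (f (case z of (a, y) \<Rightarrow> case_nat a y)) \<le> B"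
      using measurable_space[OF meas] bound by (intro AE_I2) (simp add: space_padic_haar)
  qed measurable
  from UP.integral_fst'[OF this]
  have "(\<integral>x. f x \<partial>padic_haar p) = (\<integral>a. \<integral>y. f (case_nat a y) \<partial>padic_haar p \<partial>?U)"
    by (subst iter[symmetric]) (simp add: integral_distr)
  also have "\<dots> = (\<Sum>a<p. \<integral>y. f (case_nat a y) \<partial>padic_haar p) / real p"
    by (simp add: integral_uniform_count_measure)
  finally show ?thesis .
qed

text \<open>The case \<open>k = 0\<close> is included: the second sum is then empty, so the
  truncated \<open>k - 1\<close> is harmless.\<close>

lemma gen_poly_recursion:
  assumes "k < p"
  shows "real p * gen_poly p (p * m + k) t =
    (\<Sum>a<p - k. t ^ (m * \<Sum>{..<p - 1} + \<Sum>{..<k} + a * k)) * gen_poly p m t +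
    (\<Sum>j<k. t ^ (m * \<Sum>{..<p - 1} + \<Sum>{..<k - 1} + j * (p - k))) * gen_poly p (m + 1) t"
proof -
  have p: "p > 0" using assms by simp
  let ?n = "p * m + k"
  let ?I = "\<lambda>a. \<integral>y. t ^ phi_sum p ?n (case_nat a y) \<partial>padic_haar p"
  note [measurable] = measurable_phi_sum[OF p, of ?n]
  \<comment> \<open>The base \<open>max 1 \<bar>t\<bar>\<close> makes powers monotone in the
    exponent even for \<open>\<bar>t\<bar> < 1\<close>.\<close>
  have "\<bar>t ^ phi_sum p ?n x\<bar> \<le> max 1 \<bar>t\<bar> ^ (?n * (p - 2))" if "x \<in> padic_ints p" for x
  proof -
    have "\<bar>t\<bar> ^ phi_sum p ?n x \<le> max 1 \<bar>t\<bar> ^ phi_sum p ?n x" by (intro power_mono) auto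
    also have "\<dots> \<le> max 1 \<bar>t\<bar> ^ (?n * (p - 2))"
      using phi_sum_le[OF p that] by (intro power_increasing) auto
    finally show ?thesis by (simp add: power_abs)
  qed
  then have "real p * gen_poly p ?n t = (\<Sum>a<p. ?I a)"
    unfolding gen_poly_def using p
    by (subst integral_padic_haar_first_digit) auto
  \<comment> \<open>For first digits below \<open>p - k\<close> the tail moves \<open>m\<close>
    times, for the others \<open>m + 1\<close> times.\<close>
  also have "{..<p} = {..<p - k} \<union> (\<lambda>j. p - 1 - j) ` {..<k}"
  proof -
    have "a \<in> (\<lambda>j. p - 1 - j) ` {..<k}" if "a < p" "\<not> a < p - k" for a
      using that by (intro image_eqI[of _ _ "p - 1 - a"]) auto
    then show ?thesis using assms by auto
  qed
  also have "(\<Sum>a\<in>\<dots>. ?I a) = (\<Sum>a<p - k. ?I a) + (\<Sum>j<k. ?I (p - 1 - j))"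
  proof -
    have "inj_on (\<lambda>j. p - 1 - j) {..<k}" using assms by (auto simp: inj_on_def)
    from sum.reindex[OF this, of ?I] show ?thesis
      using assms by (subst sum.union_disjoint) (auto simp: comp_def)
  qed
  also have "(\<Sum>a<p - k. ?I a) =
      (\<Sum>a<p - k. t ^ (m * \<Sum>{..<p - 1} + \<Sum>{..<k} + a * k)) * gen_poly p m t"
    unfolding sum_distrib_right gen_poly_def
    by (intro sum.cong refl, subst integral_mult_right_zero[symmetric],
        intro Bochner_Integration.integral_cong refl)
      (simp add: space_padic_haar phi_sum_case_nat_low power_add)
  also have "(\<Sum>j<k. ?I (p - 1 - j)) =
      (\<Sum>j<k. t ^ (m * \<Sum>{..<p - 1} + \<Sum>{..<k - 1} + j * (p - k))) * gen_poly p (m + 1) t"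
    unfolding sum_distrib_right gen_poly_def
    by (intro sum.cong refl, subst integral_mult_right_zero[symmetric],
        intro Bochner_Integration.integral_cong refl,
        subst phi_sum_case_nat_high) (auto simp: space_padic_haar power_add assms)
  finally show ?thesis .
qed

lemma Delta_eq_sum: "Delta (int n - 1) = \<Sum>{..<n}"
proof (cases n)
  case (Suc l)
  then show ?thesis using Sum_Ico_nat[of 0 n] by (simp add: Delta_of_nat lessThan_atLeast0 mult.commute)
qed (simp add: Delta_def)

theorem theorem4p1:
  fixes p :: nat
  assumes "p \<ge> 3"
  shows "(\<forall>(m::nat) (t::real).
            gen_poly p (p * m) t = t ^ (m * Delta (int p - 2)) * gen_poly p m t) \<and>
         (\<forall>(m::nat) (k::nat) (t::real). 0 < k \<and> k < p \<longrightarrow>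
            gen_poly p (p * m + k) t =
              1 / real p * t ^ (m * Delta (int p - 2) + Delta (int k - 1)) *
                (\<Sum>j = 0..p - k - 1. t ^ (j * k)) * gen_poly p m t +
              1 / real p * t ^ (m * Delta (int p - 2) + Delta (int k - 2)) *
                (\<Sum>j = 0..k - 1. t ^ (j * (p - k))) * gen_poly p (m + 1) t)"
proof -
  \<comment> \<open>For \<open>n = 1\<close> this is \<open>Delta (- 1) = 0\<close>, an empty sum;
    it occurs below at \<open>k = 1\<close>.\<close>
  have two: "Delta (int n - 2) = \<Sum>{..<n - 1}" if "n > 0" for n
    using Delta_eq_sum[of "n - 1"] that by (simp add: of_nat_diff)
  have p: "p > 0" using assms by simp
  show ?thesis
  proof (intro conjI allI impI)
    fix m and t :: real
    \<comment> \<open>At \<open>k = 0\<close> the first sum consists of \<open>p\<close> equal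
      powers, which cancel the factor \<open>real p\<close>.\<close>
    show "gen_poly p (p * m) t = t ^ (m * Delta (int p - 2)) * gen_poly p m t"
      using gen_poly_recursion[OF p, of m t] p by (simp add: two[OF p])
  next
    fix m k and t :: real
    assume k: "0 < k \<and> k < p"
    then have ranges: "{0..p - k - 1} = {..<p - k}" "{0..k - 1} = {..<k}" by auto
    have "gen_poly p (p * m + k) t = 1 / real p * (real p * gen_poly p (p * m + k) t)"
      using p by simp
    also have "\<dots> = 1 / real p * t ^ (m * Delta (int p - 2) + Delta (int k - 1)) *
                (\<Sum>j = 0..p - k - 1. t ^ (j * k)) * gen_poly p m t +
              1 / real p * t ^ (m * Delta (int p - 2) + Delta (int k - 2)) *
                (\<Sum>j = 0..k - 1. t ^ (j * (p - k))) * gen_poly p (m + 1) t"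
      unfolding gen_poly_recursion[OF conjunct2[OF k]] ranges two[OF p] two[OF conjunct1[OF k]] Delta_eq_sum
      by (simp only: power_add sum_distrib_left[symmetric] distrib_left mult.assoc)
    finally show "gen_poly p (p * m + k) t =
              1 / real p * t ^ (m * Delta (int p - 2) + Delta (int k - 1)) *
                (\<Sum>j = 0..p - k - 1. t ^ (j * k)) * gen_poly p m t +
              1 / real p * t ^ (m * Delta (int p - 2) + Delta (int k - 2)) *
                (\<Sum>j = 0..k - 1. t ^ (j * (p - k))) * gen_poly p (m + 1) t" .
  qed
qed

end
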